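(* Let $M$ be an odd positive integer, and let $n\ge 1$ and $k\ge 0$ be integers. Then the number of partitions of $n$ into odd parts with exactly $k$ parts of size $M$ is equal to the number of partitions $\lambda=(\lambda_1>\lambda_2>\cdots)$ of $n$ into distinct parts such that: (1) if $\lambda$ has exactly one part, then $\lfloor n/M\rfloor=k$; (2) if $\lambda$ has at least two parts, then $\lfloor (\lambda_1-\lambda_2-1)/M\rfloor=k$. *)

theory Defs
  imports Main
begin

text \<open>A partition of \<open>n\<close> is the weakly decreasing list of its (positive) parts.\<close>

definition partitions_of :: "nat \<Rightarrow> nat list set" where
  "partitions_of n = {xs. sorted_wrt (\<ge>) xs \<and> (\<forall>x\<in>set xs. x > 0) \<and> sum_list xs = n}"

definition odd_partitions :: "nat \<Rightarrow> nat list set" where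
  "odd_partitions n = {xs \<in> partitions_of n. \<forall>x\<in>set xs. odd x}"

definition distinct_partitions :: "nat \<Rightarrow> nat list set" where
  "distinct_partitions n = {xs \<in> partitions_of n. distinct xs}"

text \<open>The following fact guarantees that the cardinalities of sets of partitions are genuine.\<close>

lemma finite_partitions_of: "finite (partitions_of n)"
proof (rule finite_subset)
  show "partitions_of n \<subseteq> {xs. set xs \<subseteq> {..n} \<and> length xs \<le> n}"
  proof
    fix xs assume "xs \<in> partitions_of n"
    then have pos: "\<forall>x\<in>set xs. x > 0" and sum: "sum_list xs = n"
      by (auto simp: partitions_of_def)
    have "length xs \<le> sum_list xs"
      using pos by (induction xs) auto
    moreover have "set xs \<subseteq> {..n}"
      using sum member_le_sum_list by fastforce
    ultimately show "xs \<in> {xs. set xs \<subseteq> {..n} \<and> length xs \<le> n}"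
      using sum by simp
  qed
  show "finite {xs. set xs \<subseteq> {..n} \<and> length xs \<le> n}"
    by (rule finite_lists_length_le) simp
qed

end

theory Submission
  imports Defs "HOL-Library.Multiset" "HOL-Library.Nat_Bijection"
begin

text \<open>
  It suffices to compare, for every \<open>k\<close>, the partitions whose statistic is \<^emph>\<open>at least\<close> \<open>k\<close>.
  A partition of \<open>n\<close> into odd parts with at least \<open>k\<close> parts \<open>M\<close> is one of \<open>n - k * M\<close> with
  \<open>k\<close> copies of \<open>M\<close> added. On the other side, read \<open>\<lambda>\<^sub>2 + 1\<close> as \<open>0\<close> when there is only one
  part; then both conditions say \<open>(\<lambda>\<^sub>1 - (\<lambda>\<^sub>2 + 1)) div M = k\<close>, and this quotient is at least \<open>k\<close>
  exactly if \<open>k * M\<close> can be subtracted from \<open>\<lambda>\<^sub>1\<close> with the parts staying distinct (a single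
  part \<open>k * M\<close> may vanish altogether), which leaves a partition of \<open>n - k * M\<close> into
  distinct parts. So both cumulative counts reduce to Euler's theorem that \<open>n - k * M\<close> has as
  many partitions into odd parts as into distinct parts.

  Euler's theorem is proved by Glaisher's bijection: a part \<open>j\<close> of multiplicity \<open>c\<close> is replaced
  by the parts \<open>j * 2 ^ a\<close>, where \<open>a\<close> runs over the binary digits \<open>1\<close> of \<open>c\<close>. This can be
  undone since every positive integer is \<open>j * 2 ^ a\<close> for exactly one odd \<open>j\<close> and one \<open>a\<close>.
\<close>

section \<open>Partitions as multisets and as sets\<close>

definition odd_msets :: "nat \<Rightarrow> nat multiset set" where
  "odd_msets n = {m. sum_mset m = n \<and> (\<forall>j\<in>#m. odd j)}"

definition positive_sets :: "nat \<Rightarrow> nat set set" where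
  "positive_sets n = {S. finite S \<and> 0 \<notin> S \<and> \<Sum>S = n}"

lemma sorted_wrt_ge_iff_sorted_rev: "sorted_wrt (\<ge>) xs \<longleftrightarrow> sorted (rev xs)"
  for xs :: "'a::linorder list"
  by (simp add: sorted_wrt_rev)

lemma bij_betw_mset_odd_partitions: "bij_betw mset (odd_partitions n) (odd_msets n)"
proof (rule bij_betw_byWitness[where f' = "\<lambda>m. rev (sorted_list_of_multiset m)"])
  show "\<forall>xs\<in>odd_partitions n. rev (sorted_list_of_multiset (mset xs)) = xs"
  proof
    fix xs assume "xs \<in> odd_partitions n"
    then have "sorted (rev xs)"
      by (simp add: odd_partitions_def partitions_of_def sorted_wrt_ge_iff_sorted_rev)
    then have "sort xs = rev xs"
      by (intro properties_for_sort) auto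
    then show "rev (sorted_list_of_multiset (mset xs)) = xs"
      by simp
  qed
  show "\<forall>m\<in>odd_msets n. mset (rev (sorted_list_of_multiset m)) = m"
    by simp
  show "mset ` odd_partitions n \<subseteq> odd_msets n"
    by (auto simp: odd_partitions_def partitions_of_def odd_msets_def sum_mset_sum_list)
  show "(\<lambda>m. rev (sorted_list_of_multiset m)) ` odd_msets n \<subseteq> odd_partitions n"
  proof
    fix xs assume "xs \<in> (\<lambda>m. rev (sorted_list_of_multiset m)) ` odd_msets n"
    then obtain m where "m \<in> odd_msets n" and xs: "xs = rev (sorted_list_of_multiset m)"
      by blast
    then have "\<forall>x\<in>set xs. odd x" "sum_list xs = n"
      using sum_mset_sum_list[of xs] by (simp_all add: odd_msets_def)
    moreover have "sorted_wrt (\<ge>) xs"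
      by (simp add: xs sorted_wrt_ge_iff_sorted_rev)
    moreover from calculation have "\<forall>x\<in>set xs. x > 0"
      by (blast intro: odd_pos)
    ultimately show "xs \<in> odd_partitions n"
      unfolding odd_partitions_def partitions_of_def by blast
  qed
qed

lemma bij_betw_set_distinct_partitions:
  "bij_betw set (distinct_partitions n) (positive_sets n)"
proof (rule bij_betw_byWitness[where f' = "\<lambda>S. rev (sorted_list_of_set S)"])
  show "\<forall>xs\<in>distinct_partitions n. rev (sorted_list_of_set (set xs)) = xs"
  proof
    fix xs assume "xs \<in> distinct_partitions n"
    then have "sorted (rev xs)" "distinct (rev xs)"
      by (simp_all add: distinct_partitions_def partitions_of_def sorted_wrt_ge_iff_sorted_rev)
    then have "sorted_list_of_set (set (rev xs)) = rev xs"
      by (intro sorted_list_of_set.idem_if_sorted_distinct)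
    then show "rev (sorted_list_of_set (set xs)) = xs"
      by simp
  qed
  show "\<forall>S\<in>positive_sets n. set (rev (sorted_list_of_set S)) = S"
    by (simp add: positive_sets_def)
  show "set ` distinct_partitions n \<subseteq> positive_sets n"
    by (auto simp: distinct_partitions_def partitions_of_def positive_sets_def
        distinct_sum_list_conv_Sum)
  show "(\<lambda>S. rev (sorted_list_of_set S)) ` positive_sets n \<subseteq> distinct_partitions n"
    by (auto simp: distinct_partitions_def partitions_of_def positive_sets_def
        sorted_wrt_ge_iff_sorted_rev distinct_sum_list_conv_Sum intro: gr0I)
qed

section \<open>Glaisher's bijection and Euler's theorem\<close>

lemma odd_times_power_2_inject:
  fixes i j :: nat
  assumes "odd i" "odd j"
  shows "i * 2 ^ a = j * 2 ^ b \<longleftrightarrow> i = j \<and> a = b"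
proof
  assume "i * 2 ^ a = j * 2 ^ b"
  then show "i = j \<and> a = b"
  proof (induction a arbitrary: b)
    case 0
    then show ?case using assms by (cases b) auto
  next
    case (Suc a)
    then show ?case using assms by (cases b) auto
  qed
qed simp

lemma ex_odd_times_power_2:
  fixes x :: nat
  assumes "x > 0"
  shows "\<exists>j a. odd j \<and> x = j * 2 ^ a"
  using assms
proof (induction x rule: less_induct)
  case (less x)
  show ?case
  proof (cases "even x")
    case True
    then obtain y where y: "x = 2 * y" by blast
    with less.prems less.IH[of y] obtain j a where "odd j" "y = j * 2 ^ a" by auto
    with y have "odd j \<and> x = j * 2 ^ Suc a" by simp
    then show ?thesis by blast
  next
    case False
    then show ?thesis by (intro exI[of _ x] exI[of _ 0]) simp
  qed
qed

text \<open>
  For a number \<open>c\<close>, \<open>set_decode c\<close> is the set of positions of the digit \<open>1\<close> in the binary expansion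
  of \<open>c\<close>; \<open>set_encode\<close> recovers \<open>c\<close> as a sum of powers of \<open>2\<close>. The multiset that is merged from a
  set is given by its multiplicities, so that their binary expansions are immediate.
\<close>

definition split_parts :: "nat multiset \<Rightarrow> nat set" where
  "split_parts m = (\<Union>j\<in>set_mset m. (\<lambda>a. j * 2 ^ a) ` set_decode (count m j))"

definition merge_parts :: "nat set \<Rightarrow> nat multiset" where
  "merge_parts S = Abs_multiset (\<lambda>j. if odd j then set_encode {a. j * 2 ^ a \<in> S} else 0)"

lemma finite_exponents:
  fixes j :: nat
  assumes "finite S" "odd j"
  shows "finite {a. j * 2 ^ a \<in> S}"
proof (rule finite_imageD)
  show "finite ((\<lambda>a. j * 2 ^ a) ` {a. j * 2 ^ a \<in> S})"
    by (rule finite_subset[OF _ \<open>finite S\<close>]) auto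
  show "inj_on (\<lambda>a. j * 2 ^ a) {a. j * 2 ^ a \<in> S}"
    using assms(2) by (auto simp: inj_on_def odd_times_power_2_inject)
qed

lemma count_merge_parts:
  assumes "finite S"
  shows "count (merge_parts S) j = (if odd j then set_encode {a. j * 2 ^ a \<in> S} else 0)"
proof -
  let ?c = "\<lambda>j. if odd j then set_encode {a. j * 2 ^ a \<in> S} else 0"
  \<comment> \<open>Finite support: a part of positive multiplicity is bounded by a multiple of it in \<open>S\<close>.\<close>
  have "{j. 0 < ?c j} \<subseteq> (\<Union>x\<in>S. {..x})"
  proof
    fix j assume "j \<in> {j. 0 < ?c j}"
    then have "set_encode {a. j * 2 ^ a \<in> S} \<noteq> set_encode {}"
      unfolding set_encode_empty by (auto split: if_splits)
    then have "{a. j * 2 ^ a \<in> S} \<noteq> {}"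
      by (rule contrapos_nn) (rule arg_cong)
    then obtain a where a: "j * 2 ^ a \<in> S" by blast
    have "j \<le> j * 2 ^ a" by simp
    with a show "j \<in> (\<Union>x\<in>S. {..x})" by blast
  qed
  then have "finite {j. 0 < ?c j}"
    by (rule finite_subset) (simp add: assms)
  then show ?thesis
    by (simp add: merge_parts_def)
qed

text \<open>
  By uniqueness of the odd factor only the part \<open>j\<close> of \<open>m\<close> can contribute \<open>j * 2 ^ a\<close>, so the
  binary expansion of each multiplicity can be read off from the split set.
\<close>

lemma times_power_2_in_split_parts:
  assumes "\<forall>i\<in>#m. odd i" "odd j"
  shows "j * 2 ^ a \<in> split_parts m \<longleftrightarrow> a \<in> set_decode (count m j)"
proof
  assume "j * 2 ^ a \<in> split_parts m"
  then obtain i b where i: "i \<in># m" and b: "b \<in> set_decode (count m i)"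
    and eq: "j * 2 ^ a = i * 2 ^ b"
    by (auto simp only: split_parts_def)
  have "odd i" using assms(1) i by blast
  with eq have "j = i \<and> a = b"
    using odd_times_power_2_inject[OF assms(2), of i a b] by blast
  with b show "a \<in> set_decode (count m j)" by simp
next
  assume a: "a \<in> set_decode (count m j)"
  have "j \<in># m"
  proof (rule ccontr)
    assume "j \<notin># m"
    then have "count m j = 0" by (simp only: not_in_iff)
    with a show False by (simp only: set_decode_zero empty_iff)
  qed
  with a show "j * 2 ^ a \<in> split_parts m"
    unfolding split_parts_def by (blast intro: UN_I imageI)
qed

lemma sum_mset_eq_sum_count: "sum_mset m = (\<Sum>j\<in>set_mset m. j * count m j)"
  for m :: "nat multiset"
proof -
  obtain xs where "m = mset xs"
    using ex_mset[of m] by metis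
  then show ?thesis
    using sum_list_map_eq_sum_count[of "\<lambda>j. j" xs]
    by (simp add: sum_mset_sum_list count_mset mult.commute)
qed

text \<open>
  The sum is preserved because \<open>j\<close> times a multiplicity \<open>c\<close> is the sum of \<open>j * 2 ^ a\<close> over the
  binary digits \<open>1\<close> of \<open>c\<close>, and different odd \<open>j\<close> give disjoint sets of parts.
\<close>

lemma split_parts_in_positive_sets:
  assumes "m \<in> odd_msets n"
  shows "split_parts m \<in> positive_sets n"
proof -
  have odd: "\<forall>j\<in>#m. odd j" and sum: "sum_mset m = n"
    using assms by (auto simp: odd_msets_def)
  have "\<Sum>(split_parts m) =
      (\<Sum>j\<in>set_mset m. \<Sum>((\<lambda>a. j * 2 ^ a) ` set_decode (count m j)))"
    unfolding split_parts_def
  proof (rule sum.UNION_disjoint)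
    have "j = i" if "i \<in># m" "j \<in># m" "i * 2 ^ a = j * 2 ^ b" for i j a b
      using odd that odd_times_power_2_inject[of i j a b] by blast
    then show "\<forall>i\<in>set_mset m. \<forall>j\<in>set_mset m. i \<noteq> j \<longrightarrow>
        (\<lambda>a. i * 2 ^ a) ` set_decode (count m i) \<inter>
        (\<lambda>a. j * 2 ^ a) ` set_decode (count m j) = {}"
      by blast
  qed simp_all
  also have "\<dots> = (\<Sum>j\<in>set_mset m. j * set_encode (set_decode (count m j)))"
  proof (rule sum.cong[OF refl])
    fix j assume "j \<in># m"
    then have "inj_on (\<lambda>a. j * 2 ^ a) (set_decode (count m j))"
      using odd by (auto simp: inj_on_def odd_times_power_2_inject)
    then show "\<Sum>((\<lambda>a. j * 2 ^ a) ` set_decode (count m j)) =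
        j * set_encode (set_decode (count m j))"
      by (simp add: sum.reindex set_encode_def sum_distrib_left)
  qed
  also have "\<dots> = n"
    by (simp add: sum_mset_eq_sum_count sum[symmetric])
  finally have "\<Sum>(split_parts m) = n" .
  moreover have "finite (split_parts m)"
    by (simp add: split_parts_def)
  moreover have "0 \<notin># m"
    using odd even_zero by blast
  then have "0 \<notin> split_parts m"
    by (auto simp: split_parts_def)
  ultimately show ?thesis
    by (simp only: positive_sets_def mem_Collect_eq not_False_eq_True simp_thms)
qed

lemma merge_split_parts:
  assumes "m \<in> odd_msets n"
  shows "merge_parts (split_parts m) = m"
proof (rule multiset_eqI)
  fix j
  have odd: "\<forall>i\<in>#m. odd i"
    using assms by (simp add: odd_msets_def)
  have "finite (split_parts m)"
    using split_parts_in_positive_sets[OF assms] by (simp add: positive_sets_def)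
  moreover have "count m j = 0" if "even j"
    using odd that by (auto simp: count_eq_zero_iff)
  ultimately show "count (merge_parts (split_parts m)) j = count m j"
    using odd by (simp add: count_merge_parts times_power_2_in_split_parts)
qed

lemma odd_in_merge_parts:
  assumes "finite S" "j \<in># merge_parts S"
  shows "odd j"
  using assms(2) unfolding count_greater_zero_iff[symmetric] count_merge_parts[OF assms(1)]
  by (auto split: if_splits)

lemma split_merge_parts:
  assumes "finite S" "0 \<notin> S"
  shows "split_parts (merge_parts S) = S"
proof (rule set_eqI)
  fix x
  show "x \<in> split_parts (merge_parts S) \<longleftrightarrow> x \<in> S"
  proof (cases "x = 0")
    case True
    have "0 \<notin># merge_parts S"
      using odd_in_merge_parts[OF assms(1), of 0] by auto
    with True show ?thesis
      using assms(2) by (auto simp: split_parts_def)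
  next
    case False
    then obtain j a where "odd j" "x = j * 2 ^ a"
      using ex_odd_times_power_2 by blast
    then show ?thesis
      using odd_in_merge_parts[OF assms(1)] finite_exponents[OF assms(1)]
      by (simp add: times_power_2_in_split_parts count_merge_parts[OF assms(1)])
  qed
qed

text \<open>
  The sum is inherited from splitting, which preserves sums and takes the merged multiset back
  to \<open>S\<close>.
\<close>

lemma merge_parts_in_odd_msets:
  assumes "S \<in> positive_sets n"
  shows "merge_parts S \<in> odd_msets n"
proof -
  have S: "finite S" "0 \<notin> S" "\<Sum>S = n"
    using assms by (auto simp: positive_sets_def)
  have "merge_parts S \<in> odd_msets (sum_mset (merge_parts S))"
    using odd_in_merge_parts[OF S(1)] by (simp add: odd_msets_def)
  moreover from split_parts_in_positive_sets[OF this] have "sum_mset (merge_parts S) = n"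
    using S by (simp add: split_merge_parts positive_sets_def)
  ultimately show ?thesis by simp
qed

lemma bij_betw_split_parts: "bij_betw split_parts (odd_msets n) (positive_sets n)"
  by (rule bij_betw_byWitness[where f' = merge_parts])
    (auto simp: merge_split_parts split_merge_parts split_parts_in_positive_sets
      merge_parts_in_odd_msets, auto simp: positive_sets_def split_merge_parts)

theorem euler_odd_distinct_partitions:
  "card (odd_partitions n) = card (distinct_partitions n)"
  using bij_betw_same_card[OF bij_betw_mset_odd_partitions[of n]]
    bij_betw_same_card[OF bij_betw_split_parts[of n]]
    bij_betw_same_card[OF bij_betw_set_distinct_partitions[of n]]
  by simp

section \<open>Partitions with statistic at least \<open>k\<close>\<close>

lemma add_replicate_in_odd_msets_iff:
  assumes "odd M"
  shows "m + replicate_mset k M \<in> odd_msets n \<longleftrightarrow> k * M \<le> n \<and> m \<in> odd_msets (n - k * M)"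
proof -
  have "sum_mset (m + replicate_mset k M) = n \<longleftrightarrow> k * M \<le> n \<and> sum_mset m = n - k * M"
    by auto
  moreover have "(\<forall>j\<in>#m + replicate_mset k M. odd j) \<longleftrightarrow> (\<forall>j\<in>#m. odd j)"
    using assms unfolding set_mset_union in_replicate_mset ball_Un by (metis in_replicate_mset)
  ultimately show ?thesis
    unfolding odd_msets_def by blast
qed

lemma card_odd_partitions_count_ge:
  assumes "odd M"
  shows "card {xs \<in> odd_partitions n. k \<le> count_list xs M} =
    (if k * M \<le> n then card (odd_partitions (n - k * M)) else 0)"
proof -
  let ?A = "{m \<in> odd_msets n. k \<le> count m M}"
  let ?add = "\<lambda>m. m + replicate_mset k M"
  have "bij_betw mset {xs \<in> odd_partitions n. k \<le> count_list xs M} ?A"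
    using bij_betw_mset_odd_partitions[of n]
    by (rule bij_betw_Collect) (simp add: count_mset)
  then have *: "card {xs \<in> odd_partitions n. k \<le> count_list xs M} = card ?A"
    by (rule bij_betw_same_card)
  have "\<exists>m'. m = ?add m'" if "k \<le> count m M" for m
    using that by (metis count_le_replicate_mset_subset_eq subset_mset.diff_add)
  moreover have "k \<le> count (?add m) M" for m
    by simp
  ultimately have A: "?A = ?add ` {m. ?add m \<in> odd_msets n}"
    by blast
  show ?thesis
  proof (cases "k * M \<le> n")
    case True
    then have "?A = ?add ` odd_msets (n - k * M)"
      unfolding A add_replicate_in_odd_msets_iff[OF assms] by simp
    moreover have "inj ?add"
      by (simp add: inj_def)
    ultimately have "card ?A = card (odd_msets (n - k * M))"
      by (simp only: card_image inj_on_subset[OF _ subset_UNIV])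
    then show ?thesis
      using True * bij_betw_same_card[OF bij_betw_mset_odd_partitions[of "n - k * M"]]
      by (simp only: if_True)
  next
    case False
    then have "?A = {}"
      unfolding A add_replicate_in_odd_msets_iff[OF assms] by simp
    with False * show ?thesis
      by (simp only: card.empty if_False)
  qed
qed

lemma distinct_partitions_altdef:
  "distinct_partitions n = {xs. sorted_wrt (>) xs \<and> (\<forall>x\<in>set xs. x > 0) \<and> sum_list xs = n}"
proof -
  have "sorted_wrt (\<ge>) xs \<and> distinct xs \<longleftrightarrow> sorted_wrt (>) xs" for xs :: "nat list"
    by (induction xs) (auto simp: order.order_iff_strict)
  then show ?thesis
    by (auto simp: distinct_partitions_def partitions_of_def)
qed

text \<open>
  The value for a single part is what a second part of size \<open>-1\<close> would give; with it one
  statistic covers both cases of the theorem.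
\<close>

fun leading_gap :: "nat list \<Rightarrow> nat" where
  "leading_gap [] = 0"
| "leading_gap [x] = x"
| "leading_gap (x # y # _) = x - y - 1"

lemma leading_gap_le_sum_list: "leading_gap xs \<le> sum_list xs"
  by (induction xs rule: leading_gap.induct) auto

text \<open>
  Adding \<open>d\<close> to the largest part produces the partitions with leading gap at least \<open>d\<close>, where
  the empty partition has to be treated as having largest part \<open>0\<close>: it yields the single part \<open>d\<close>.
  This part is positive because \<open>n \<ge> 1\<close>: the empty partition occurs only for \<open>d = n\<close>.
\<close>

lemma card_distinct_partitions_leading_gap_ge:
  assumes "n \<ge> 1"
  shows "card {xs \<in> distinct_partitions n. d \<le> leading_gap xs} =
    (if d \<le> n then card (distinct_partitions (n - d)) else 0)"
proof (cases "d \<le> n")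
  case True
  let ?widen = "\<lambda>ys. case ys of [] \<Rightarrow> [d] | y # ws \<Rightarrow> (y + d) # ws"
  let ?narrow = "\<lambda>xs. if hd xs = d then [] else (hd xs - d) # tl xs"
  have "bij_betw ?widen (distinct_partitions (n - d))
      {xs \<in> distinct_partitions n. d \<le> leading_gap xs}"
  proof (rule bij_betw_byWitness[where f' = ?narrow])
    show "\<forall>ys\<in>distinct_partitions (n - d). ?narrow (?widen ys) = ys"
      by (auto simp: distinct_partitions_altdef split: list.splits)
    show "\<forall>xs\<in>{xs \<in> distinct_partitions n. d \<le> leading_gap xs}. ?widen (?narrow xs) = xs"
    proof
      fix xs assume "xs \<in> {xs \<in> distinct_partitions n. d \<le> leading_gap xs}"
      then show "?widen (?narrow xs) = xs"
        using assms by (cases xs rule: leading_gap.cases) (auto simp: distinct_partitions_altdef)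
    qed
    show "?widen ` distinct_partitions (n - d)
        \<subseteq> {xs \<in> distinct_partitions n. d \<le> leading_gap xs}"
    proof
      fix xs assume "xs \<in> ?widen ` distinct_partitions (n - d)"
      then obtain ys where "ys \<in> distinct_partitions (n - d)" "xs = ?widen ys" by blast
      then show "xs \<in> {xs \<in> distinct_partitions n. d \<le> leading_gap xs}"
        using assms True
        by (cases ys rule: leading_gap.cases) (auto simp: distinct_partitions_altdef)
    qed
    show "?narrow ` {xs \<in> distinct_partitions n. d \<le> leading_gap xs}
        \<subseteq> distinct_partitions (n - d)"
    proof
      fix ys assume "ys \<in> ?narrow ` {xs \<in> distinct_partitions n. d \<le> leading_gap xs}"
      then obtain xs where "xs \<in> distinct_partitions n" "d \<le> leading_gap xs" "ys = ?narrow xs"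
        by blast
      then show "ys \<in> distinct_partitions (n - d)"
        using assms
        by (cases xs rule: leading_gap.cases) (auto simp: distinct_partitions_altdef)
    qed
  qed
  with True show ?thesis
    by (simp add: bij_betw_same_card)
next
  case False
  have "d \<le> n" if "xs \<in> distinct_partitions n" "d \<le> leading_gap xs" for xs
    using that leading_gap_le_sum_list[of xs]
    by (auto simp: distinct_partitions_def partitions_of_def)
  with False have "{xs \<in> distinct_partitions n. d \<le> leading_gap xs} = {}" by blast
  with False show ?thesis by (simp only: card.empty if_False)
qed

lemma card_eq_level_from_ge_levels:
  fixes f :: "'a \<Rightarrow> nat" and g :: "'b \<Rightarrow> nat"
  assumes "finite A" "finite B"
    and "\<And>k. card {x \<in> A. k \<le> f x} = card {y \<in> B. k \<le> g y}"
  shows "card {x \<in> A. f x = k} = card {y \<in> B. g y = k}"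
proof -
  have diff: "card {x \<in> C. h x = k} = card {x \<in> C. k \<le> h x} - card {x \<in> C. Suc k \<le> h x}"
    if "finite C" for C :: "'c set" and h :: "'c \<Rightarrow> nat"
  proof -
    have "{x \<in> C. h x = k} = {x \<in> C. k \<le> h x} - {x \<in> C. Suc k \<le> h x}" by auto
    moreover have "{x \<in> C. Suc k \<le> h x} \<subseteq> {x \<in> C. k \<le> h x}" by auto
    ultimately show ?thesis
      using that by (simp add: card_Diff_subset)
  qed
  show ?thesis
    using assms by (simp add: diff)
qed

theorem theorem3p5:
  fixes M n k :: nat
  assumes "odd M" and "n \<ge> 1"
  shows "card {xs \<in> odd_partitions n. count_list xs M = k} =
         card {xs \<in> distinct_partitions n.
                 (length xs = 1 \<longrightarrow> n div M = k) \<and>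
                 (length xs \<ge> 2 \<longrightarrow> (xs ! 0 - xs ! 1 - 1) div M = k)}"
proof -
  have "M > 0"
    using assms(1) by (rule odd_pos)
  have finite: "finite (odd_partitions n)" "finite (distinct_partitions n)"
    by (simp_all add: odd_partitions_def distinct_partitions_def finite_partitions_of)
  have "card {xs \<in> odd_partitions n. count_list xs M = k} =
      card {xs \<in> distinct_partitions n. leading_gap xs div M = k}"
    using finite
  proof (rule card_eq_level_from_ge_levels)
    fix k
    have "k \<le> leading_gap xs div M \<longleftrightarrow> k * M \<le> leading_gap xs" for xs
      using \<open>M > 0\<close> by (rule less_eq_div_iff_mult_less_eq)
    then show "card {xs \<in> odd_partitions n. k \<le> count_list xs M} =
        card {xs \<in> distinct_partitions n. k \<le> leading_gap xs div M}"
      using assms by (simp add: card_odd_partitions_count_ge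
          card_distinct_partitions_leading_gap_ge euler_odd_distinct_partitions)
  qed
  also have "{xs \<in> distinct_partitions n. leading_gap xs div M = k} =
      {xs \<in> distinct_partitions n.
         (length xs = 1 \<longrightarrow> n div M = k) \<and>
         (length xs \<ge> 2 \<longrightarrow> (xs ! 0 - xs ! 1 - 1) div M = k)}"
  proof (rule Collect_cong, rule conj_cong[OF refl])
    fix xs assume "xs \<in> distinct_partitions n"
    then show "leading_gap xs div M = k \<longleftrightarrow>
        (length xs = 1 \<longrightarrow> n div M = k) \<and>
        (length xs \<ge> 2 \<longrightarrow> (xs ! 0 - xs ! 1 - 1) div M = k)"
      using \<open>n \<ge> 1\<close>
      by (cases xs rule: leading_gap.cases)
        (auto simp: distinct_partitions_def partitions_of_def)
  qed
  finally show ?thesis .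
qed

end
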